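(* Let $n$ be a positive integer, let $\mathcal{Q}=\{[1,i]: i\in[n]\}$, and let $\mathsf{Dict}_n:\{-1,1\}^n\to\{-1,1\}$ be $\mathsf{Dict}_n(x)=x_n$. Then $\mathsf{Q}^{\mathcal{Q}}(\mathsf{Dict}_n)=\Theta(n)$, with absolute implicit constants.
   Context: $[n]=\{1,\dots,n\}$ and $[1,i]=\{1,\dots,i\}$. Query model: for $\mathcal{Q}\subseteq 2^{[n]}$, a query is a pair $(S,b)$ with $S\in\mathcal{Q}$, $b\in\{-1,1\}^S$; its answer on hidden input $x\in\{-1,1\}^n$ is $\mathbb{I}[x_S=b]\in\{0,1\}$, where $x_S$ is the restriction of $x$ to the coordinates in $S$. A quantum algorithm making $T$ queries prepares $U_TO_xU_{T-1}\cdots U_1O_xU_0|\psi_0\rangle$ on a finite-dimensional space (query register, answer qubit, workspace), where $|\psi_0\rangle$ and the unitaries $U_i$ do not depend on $x$ and $O_x:|S,b\rangle|a\rangle|w\rangle\mapsto|S,b\rangle|a+\mathbb{I}[x_S=b] \bmod 2\rangle|w\rangle$; it then measures to produce an output. For a function $F:\{-1,1\}^n\to E$, $\mathsf{Q}^{\mathcal{Q}}(F)$ is the least $T$ for which some such algorithm outputs $F(x)$ with probability at least $2/3$ for every $x$. *)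

theory Defs
  imports "HOL-Analysis.Analysis"
begin

definition inputs :: "nat \<Rightarrow> (nat \<Rightarrow> int) set" where
  "inputs n = {1..n} \<rightarrow>\<^sub>E {-1, 1}"

type_synonym query = "nat set \<times> (nat \<Rightarrow> int)"

definition queries :: "nat set set \<Rightarrow> query set" where
  "queries \<Q> = (SIGMA S:\<Q>. S \<rightarrow>\<^sub>E {-1, 1})"

fun answer :: "(nat \<Rightarrow> int) \<Rightarrow> query \<Rightarrow> nat" where
  "answer x (S, b) = of_bool (restrict x S = b)"

text \<open>
  The label \<open>(q, a, w)\<close> stands for the basis vector |q>|a>|w> of the
  query register, the answer qubit and a workspace of dimension \<open>d\<close>. Vectors and matrices are
  functions on labels; their values outside \<open>basis \<Q> d\<close> are never read.
\<close>

type_synonym label = "query \<times> nat \<times> nat"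
type_synonym state = "label \<Rightarrow> complex"
type_synonym matrix = "label \<Rightarrow> label \<Rightarrow> complex"

definition basis :: "nat set set \<Rightarrow> nat \<Rightarrow> label set" where
  "basis \<Q> d = queries \<Q> \<times> {0, 1} \<times> {..<d}"

definition unit_state :: "label set \<Rightarrow> state \<Rightarrow> bool" where
  "unit_state B v \<longleftrightarrow> (\<Sum>i\<in>B. (cmod (v i))\<^sup>2) = 1"

definition apply_mat :: "label set \<Rightarrow> matrix \<Rightarrow> state \<Rightarrow> state" where
  "apply_mat B A v = (\<lambda>i. \<Sum>j\<in>B. A i j * v j)"

definition unitary_mat :: "label set \<Rightarrow> matrix \<Rightarrow> bool" where
  "unitary_mat B A \<longleftrightarrow>
     (\<forall>i\<in>B. \<forall>j\<in>B. (\<Sum>k\<in>B. cnj (A k i) * A k j) = of_bool (i = j)) \<and>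
     (\<forall>i\<in>B. \<forall>j\<in>B. (\<Sum>k\<in>B. A i k * cnj (A j k)) = of_bool (i = j))"

definition quad_form :: "label set \<Rightarrow> matrix \<Rightarrow> state \<Rightarrow> complex" where
  "quad_form B A v = (\<Sum>i\<in>B. \<Sum>j\<in>B. cnj (v i) * A i j * v j)"

text \<open>
  The final measurement is a general quantum measurement (POVM) with outcomes in the finite
  set \<open>E\<close>.
\<close>

definition povm :: "label set \<Rightarrow> 'e set \<Rightarrow> ('e \<Rightarrow> matrix) \<Rightarrow> bool" where
  "povm B E M \<longleftrightarrow> finite E \<and>
     (\<forall>e\<in>E. \<forall>v. quad_form B (M e) v \<in> \<real>\<^sub>\<ge>\<^sub>0) \<and>
     (\<forall>i\<in>B. \<forall>j\<in>B. (\<Sum>e\<in>E. M e i j) = of_bool (i = j))"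

definition outcome_prob :: "label set \<Rightarrow> ('e \<Rightarrow> matrix) \<Rightarrow> state \<Rightarrow> 'e \<Rightarrow> real" where
  "outcome_prob B M v e = Re (quad_form B (M e) v)"

fun oracle_map :: "(nat \<Rightarrow> int) \<Rightarrow> label \<Rightarrow> label" where
  "oracle_map x (q, a, w) = (q, (a + answer x q) mod 2, w)"

definition oracle_mat :: "(nat \<Rightarrow> int) \<Rightarrow> matrix" where
  "oracle_mat x i j = of_bool (i = oracle_map x j)"

primrec final_state ::
  "label set \<Rightarrow> state \<Rightarrow> (nat \<Rightarrow> matrix) \<Rightarrow> (nat \<Rightarrow> int) \<Rightarrow> nat \<Rightarrow> state" where
  "final_state B \<psi> U x 0 = apply_mat B (U 0) \<psi>"
| "final_state B \<psi> U x (Suc t) =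
     apply_mat B (U (Suc t)) (apply_mat B (oracle_mat x) (final_state B \<psi> U x t))"

definition quantum_computable ::
  "nat \<Rightarrow> nat set set \<Rightarrow> 'e set \<Rightarrow> ((nat \<Rightarrow> int) \<Rightarrow> 'e) \<Rightarrow> nat \<Rightarrow> bool" where
  "quantum_computable n \<Q> E F T \<longleftrightarrow>
     (\<exists>d \<psi> U M.
        unit_state (basis \<Q> d) \<psi> \<and>
        (\<forall>t\<le>T. unitary_mat (basis \<Q> d) (U t)) \<and>
        povm (basis \<Q> d) E M \<and>
        (\<forall>x\<in>inputs n.
           outcome_prob (basis \<Q> d) M (final_state (basis \<Q> d) \<psi> U x T) (F x) \<ge> 2 / 3))"

text \<open>
  The least number of queries for \<open>F : {-1,1}^n \<rightarrow> E\<close>, where \<open>\<Q>\<close> consists of subsets of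
  \<open>{1..n}\<close>; it is \<open>\<infinity>\<close> if no number of queries suffices.
\<close>

definition quantum_query_complexity ::
  "nat \<Rightarrow> nat set set \<Rightarrow> 'e set \<Rightarrow> ((nat \<Rightarrow> int) \<Rightarrow> 'e) \<Rightarrow> enat" where
  "quantum_query_complexity n \<Q> E F = (INF T\<in>{T. quantum_computable n \<Q> E F T}. enat T)"

definition prefix_sets :: "nat \<Rightarrow> nat set set" where
  "prefix_sets n = (\<lambda>i. {1..i}) ` {1..n}"

definition Dict :: "nat \<Rightarrow> (nat \<Rightarrow> int) \<Rightarrow> int" where
  "Dict n x = x n"

end

theory Submission
  imports Defs
begin

text \<open>
  Upper bound: learn the bits one at a time; once \<open>x\<^sub>1, \<dots>, x\<^sub>t\<close> are known, asking whether
  the prefix of length \<open>t + 1\<close> is \<open>(x\<^sub>1, \<dots>, x\<^sub>t, 1)\<close> reveals the next one. The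
  computation is reversible, so permutation matrices carry it out.

  Lower bound: the positive-weight adversary method. Give a pair \<open>x, y\<close> with \<open>x\<^sub>n \<noteq> y\<^sub>n\<close> the weight
  \<open>\<Sum> 2\<^sup>k\<^sup>-\<^sup>n\<close> over the \<open>k < n\<close> for which they agree on the first \<open>k\<close> coordinates, and consider
  the weighted sum of \<open>Re \<langle>\<psi>\<^sub>x|\<psi>\<^sub>y\<rangle>\<close>. It starts at \<open>2\<^sup>n n / 2\<close>, since each level \<open>k\<close> contributes
  \<open>1 / 2\<close> per input. A correct algorithm must bring it down by a constant factor. A query to a prefix of
  length \<open>i\<close> only affects pairs that it separates, and at level \<open>k < i\<close> there are few of these:
  \<open>2\<^sup>n\<^sup>-\<^sup>i\<close> inputs against at most \<open>2\<^sup>n\<^sup>-\<^sup>k\<close>. So the loss at level \<open>k\<close> decays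
  geometrically in \<open>i - k\<close>, and one step loses only \<open>O(2\<^sup>n)\<close> in total.
\<close>

section \<open>Adversary weights\<close>

lemma card_inputs_fixed:
  assumes "S \<subseteq> {1..n}" and "\<And>j. j \<in> S \<Longrightarrow> z j \<in> {-1, 1}"
  shows "card {y \<in> inputs n. \<forall>j\<in>S. y j = z j} = 2 ^ (n - card S)"
proof -
  have "{y \<in> inputs n. \<forall>j\<in>S. y j = z j}
      = ({1..n} \<rightarrow>\<^sub>E {-1, 1}) \<inter> {y. \<forall>j\<in>S. y j = z j}"
    by (auto simp: inputs_def)
  also have "\<dots> = (\<Pi>\<^sub>E j\<in>{1..n}. if j \<in> S then {z j} else {-1, 1})"
  proof (intro equalityI subsetI)
    fix y assume y: "y \<in> (\<Pi>\<^sub>E j\<in>{1..n}. if j \<in> S then {z j} else {-1, 1})"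
    have "y j = z j" if "j \<in> S" for j
      using PiE_mem[OF y, of j] that assms(1) by auto
    moreover from this have "y j \<in> {-1, 1}" if "j \<in> {1..n}" for j
      using PiE_mem[OF y that] assms(2)[of j] by (cases "j \<in> S") auto
    ultimately show "y \<in> ({1..n} \<rightarrow>\<^sub>E {-1, 1}) \<inter> {y. \<forall>j\<in>S. y j = z j}"
      using y by (simp add: PiE_iff)
  qed (simp add: PiE_iff)
  also have "card \<dots> = (\<Prod>j\<in>{1..n}. if j \<in> S then 1 else 2)"
    by (subst card_PiE) (auto intro!: prod.cong)
  also have "\<dots> = 2 ^ card ({1..n} - S)"
    by (subst prod.If_cases) (auto simp: Diff_eq)
  also have "card ({1..n} - S) = n - card S"
    using assms(1) by (simp add: card_Diff_subset finite_subset)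
  finally show ?thesis .
qed

lemma finite_inputs [simp]: "finite (inputs n)"
  by (simp add: inputs_def finite_PiE)

lemma card_inputs: "card (inputs n) = 2 ^ n"
  using card_inputs_fixed[of "{}" n] by simp

definition agree :: "nat \<Rightarrow> (nat \<Rightarrow> int) \<Rightarrow> (nat \<Rightarrow> int) \<Rightarrow> bool" where
  "agree k x y \<longleftrightarrow> (\<forall>j\<in>{1..k}. x j = y j)"

lemma agree_sym: "agree k x y \<longleftrightarrow> agree k y x"
  unfolding agree_def by (intro ball_cong refl eq_commute)

lemma card_agree:
  assumes "k \<le> n" and "\<And>j. j \<in> {1..k} \<Longrightarrow> z j \<in> {-1, 1}"
  shows "card {y \<in> inputs n. agree k z y} = 2 ^ (n - k)"
proof -
  have "{y \<in> inputs n. agree k z y} = {y \<in> inputs n. \<forall>j\<in>{1..k}. y j = z j}"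
    by (subst agree_sym) (simp only: agree_def)
  then show ?thesis
    using card_inputs_fixed[of "{1..k}" n z] assms by simp
qed

text \<open>The adversary matrix. For inputs with different last coordinates and a longest common
  prefix of length m < n, the entry is (2^(m+1) - 1) / 2^n. It is kept as a sum over levels because
  row sums and query losses are computed one level at a time.\<close>

definition weight :: "nat \<Rightarrow> (nat \<Rightarrow> int) \<Rightarrow> (nat \<Rightarrow> int) \<Rightarrow> real" where
  "weight n x y = (\<Sum>k<n. if agree k x y \<and> x n \<noteq> y n then 2 ^ k / 2 ^ n else 0)"

lemma weight_sym: "weight n x y = weight n y x"
  unfolding weight_def using agree_sym by (intro sum.cong) auto

lemma weight_nonneg: "0 \<le> weight n x y"
  by (auto simp: weight_def intro!: sum_nonneg)

lemma weight_eq_0: "x n = y n \<Longrightarrow> weight n x y = 0"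
  by (simp add: weight_def)

lemma inputs_memD: "x \<in> inputs n \<Longrightarrow> j \<in> {1..n} \<Longrightarrow> x j \<in> {-1, 1}"
  by (auto simp: inputs_def PiE_iff)

text \<open>At level \<open>k < n\<close> the first \<open>k\<close> coordinates of \<open>y\<close>
  are those of \<open>x\<close> and the last is flipped. This leaves 2^(n-k-1) choices of weight
  2^(k-n) each, so every level contributes 1/2.\<close>

lemma sum_weight:
  assumes "x \<in> inputs n"
  shows "(\<Sum>y\<in>inputs n. weight n x y) = real n / 2"
proof -
  have count: "card {y \<in> inputs n. agree k x y \<and> x n \<noteq> y n} = 2 ^ (n - Suc k)" if "k < n" for k
  proof -
    \<comment> \<open>In {-1, 1}, differing from \<open>x n\<close> means being equal to
      \<open>- x n\<close>, so the condition prescribes k + 1 coordinates of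
      \<open>y\<close>.\<close>
    have "(\<forall>j\<in>insert n {1..k}. y j = (x(n := - x n)) j) \<longleftrightarrow> agree k x y \<and> x n \<noteq> y n"
      if y: "y \<in> inputs n" for y
    proof -
      have "(\<forall>j\<in>{1..k}. y j = (x(n := - x n)) j) \<longleftrightarrow> (\<forall>j\<in>{1..k}. y j = x j)"
        using \<open>k < n\<close> by (intro ball_cong) auto
      moreover have "y n = - x n \<longleftrightarrow> x n \<noteq> y n"
      proof -
        have "y n \<in> {-1, 1}" "x n \<in> {-1, 1}"
          using inputs_memD[OF y, of n] inputs_memD[OF assms, of n] \<open>k < n\<close> by auto
        then show ?thesis by (elim insertE emptyE) simp_all
      qed
      ultimately show ?thesis
        by (subst agree_sym) (simp only: agree_def ball_simps fun_upd_same, blast)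
    qed
    then have "{y \<in> inputs n. agree k x y \<and> x n \<noteq> y n}
        = {y \<in> inputs n. \<forall>j\<in>insert n {1..k}. y j = (x(n := - x n)) j}"
      by blast
    also have "card \<dots> = 2 ^ (n - card (insert n {1..k}))"
    proof (rule card_inputs_fixed)
      show "insert n {1..k} \<subseteq> {1..n}" using that by auto
      show "(x(n := - x n)) j \<in> {-1, 1}" if "j \<in> insert n {1..k}" for j
        using that \<open>k < n\<close> inputs_memD[OF assms, of j] by (cases "j = n") auto
    qed
    also have "card (insert n {1..k}) = Suc k"
      using that by simp
    finally show ?thesis .
  qed
  have "(\<Sum>y\<in>inputs n. weight n x y)
      = (\<Sum>k<n. \<Sum>y\<in>inputs n. if agree k x y \<and> x n \<noteq> y n then 2 ^ k / 2 ^ n else 0)"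
    unfolding weight_def by (rule sum.swap)
  also have "\<dots> = (\<Sum>k<n. 1 / 2)"
  proof (rule sum.cong)
    fix k assume "k \<in> {..<n}"
    then have k: "k < n" by simp
    have "(\<Sum>y\<in>inputs n. if agree k x y \<and> x n \<noteq> y n then 2 ^ k / 2 ^ n else (0::real))
        = real (card {y \<in> inputs n. agree k x y \<and> x n \<noteq> y n}) * (2 ^ k / 2 ^ n)"
      by (simp add: sum.inter_filter[symmetric])
    also have "\<dots> = 2 ^ (n - Suc k + k) / 2 ^ n"
      by (simp add: count k power_add)
    also have "\<dots> = 1 / 2"
      using k power_add[of "2::real" "n - 1" 1] by simp
    finally show "(\<Sum>y\<in>inputs n. if agree k x y \<and> x n \<noteq> y n then 2 ^ k / 2 ^ n else (0::real)) = 1 / 2" .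
  qed simp
  finally show ?thesis by simp
qed

section \<open>Weighted loss across one prefix cut\<close>

text \<open>The bound is the fixed point of s -> r * s + r and therefore survives the induction. It
  equals 2 for the ratio 2/3 and 3 for the ratio 3/4.\<close>

lemma sum_power_diff_le:
  fixes r :: real
  assumes "0 \<le> r" and "r < 1"
  shows "(\<Sum>k<i. r ^ (i - k)) \<le> r / (1 - r)"
proof (induction i)
  case 0
  show ?case using assms by simp
next
  case (Suc i)
  have "(\<Sum>k<Suc i. r ^ (Suc i - k)) = r * (\<Sum>k<i. r ^ (i - k)) + r"
    by (simp add: sum_distrib_left Suc_diff_le)
  also have "\<dots> \<le> r * (r / (1 - r)) + r"
    using Suc assms by (intro add_right_mono mult_left_mono)
  also have "\<dots> = r / (1 - r)"
    using assms by (simp add: field_simps)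
  finally show ?case .
qed

text \<open>\<open>N x\<close> stands for the squared norm that the state of \<open>x\<close> puts
  on one query, \<open>D x y\<close> for the drop in overlap caused by that query, and
  \<open>A\<close> for the inputs it answers with 1. At level \<open>k\<close> the term
  \<open>c k * N x\<close> meets 2^(n-k) partners of weight 2^(k-n), while \<open>N y / c k\<close>
  is charged at most card A = 2^(n-i) times. The geometric sums over \<open>k < i\<close> give 2 + 3
  = 5.\<close>

lemma sum_weight_cut_le:
  fixes N :: "(nat \<Rightarrow> int) \<Rightarrow> real" and D :: "(nat \<Rightarrow> int) \<Rightarrow> (nat \<Rightarrow> int) \<Rightarrow> real"
  assumes i: "i \<in> {1..n}" and b: "\<And>j. j \<in> {1..i} \<Longrightarrow> b j \<in> {-1, 1}"
    and N: "\<And>x. 0 \<le> N x"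
    and D: "\<And>x y c. c > 0 \<Longrightarrow> D x y \<le> c * N x + N y / c"
  defines "A \<equiv> {x \<in> inputs n. agree i b x}"
  shows "(\<Sum>x\<in>A. \<Sum>y\<in>inputs n - A. weight n x y * D x y) \<le> 5 * (\<Sum>x\<in>inputs n. N x)"
proof -
  define s where "s = (\<Sum>x\<in>inputs n. N x)"
  \<comment> \<open>AM-GM parameter at level \<open>k\<close>: both \<open>c k\<close> and \<open>2 ^ k / 2 ^ i / c k\<close> must be summable over
    \<open>k < i\<close>. The natural choice \<open>2 powr ((k - i) / 2)\<close> is replaced by one with rational values.\<close>
  define c :: "nat \<Rightarrow> real" where "c k = (2 / 3) ^ (i - k)" for k
  have c: "c k > 0" for k by (simp add: c_def)
  have s: "0 \<le> s" unfolding s_def by (intro sum_nonneg N)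
  define f where "f k x y = (if agree k x y \<and> x n \<noteq> y n then 2 ^ k / 2 ^ n else 0) * D x y" for k x y
  define g where "g k x y = (if agree k x y then 2 ^ k / 2 ^ n * (c k * N x) else 0)" for k x y
  \<comment> \<open>Agreement is kept in \<open>g\<close>, where it limits the partners of
    \<open>x\<close>; in \<open>h\<close> the size of \<open>A\<close> limits the partners of
    \<open>y\<close>.\<close>
  define h where "h k y = 2 ^ k / 2 ^ n * (N y / c k)" for k y
  have gh_nonneg: "0 \<le> g k x y" "0 \<le> h k y" for k x y
    unfolding g_def h_def using N c[of k] by (auto intro!: mult_nonneg_nonneg divide_nonneg_pos)
  have f_le: "f k x y \<le> g k x y + h k y" for k x y
  proof (cases "agree k x y \<and> x n \<noteq> y n")
    case True
    then have "f k x y = 2 ^ k / 2 ^ n * D x y" by (simp add: f_def)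
    also have "\<dots> \<le> 2 ^ k / 2 ^ n * (c k * N x + N y / c k)"
      by (intro mult_left_mono D c) simp
    finally show ?thesis using True by (simp only: g_def h_def distrib_left if_True)
  next
    case False
    then have "f k x y = 0" by (auto simp: f_def)
    then show ?thesis using gh_nonneg(1)[of k x y] gh_nonneg(2)[of k y] by simp
  qed
  have level: "(\<Sum>x\<in>A. \<Sum>y\<in>inputs n - A. f k x y) \<le> ((2 / 3) ^ (i - k) + (3 / 4) ^ (i - k)) * s"
    if k: "k < i" for k
  proof -
    have "(\<Sum>x\<in>A. \<Sum>y\<in>inputs n - A. f k x y) \<le> (\<Sum>x\<in>A. \<Sum>y\<in>inputs n - A. g k x y + h k y)"
      by (intro sum_mono f_le)
    also have "\<dots> \<le> (\<Sum>x\<in>A. \<Sum>y\<in>inputs n. g k x y + h k y)"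
      by (intro sum_mono sum_mono2) (auto intro: add_nonneg_nonneg gh_nonneg)
    also have "\<dots> = (\<Sum>x\<in>A. \<Sum>y\<in>inputs n. g k x y) + real (card A) * (\<Sum>y\<in>inputs n. h k y)"
      by (simp add: sum.distrib)
    also have "(\<Sum>x\<in>A. \<Sum>y\<in>inputs n. g k x y) = (\<Sum>x\<in>A. c k * N x)"
    proof (rule sum.cong)
      fix x assume "x \<in> A"
      then have x: "x \<in> inputs n" by (simp add: A_def)
      have "(\<Sum>y\<in>inputs n. g k x y)
          = real (card {y \<in> inputs n. agree k x y}) * (2 ^ k / 2 ^ n * (c k * N x))"
        unfolding g_def by (simp add: sum.inter_filter[symmetric])
      also have "card {y \<in> inputs n. agree k x y} = 2 ^ (n - k)"
        using k i inputs_memD[OF x] by (intro card_agree) auto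
      also have "real (2 ^ (n - k)) * (2 ^ k / 2 ^ n * (c k * N x)) = c k * N x"
        using k i power_add[of "2::real" "n - k" k] by simp
      finally show "(\<Sum>y\<in>inputs n. g k x y) = c k * N x" .
    qed simp
    also have "\<dots> \<le> (\<Sum>x\<in>inputs n. c k * N x)"
      using N c[of k] by (intro sum_mono2) (auto simp: A_def)
    also have "\<dots> = c k * s"
      by (simp add: s_def sum_distrib_left)
    also have "(\<Sum>y\<in>inputs n. h k y) = 2 ^ k / 2 ^ n / c k * s"
      by (simp add: h_def s_def sum_distrib_left sum_divide_distrib)
    also have "card A = 2 ^ (n - i)"
      unfolding A_def using i b by (intro card_agree) auto
    also have "real (2 ^ (n - i)) * (2 ^ k / 2 ^ n / c k * s) = (3 / 4) ^ (i - k) * s"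
    proof -
      have n: "(2::real) ^ n = 2 ^ (n - i) * (2 ^ (i - k) * 2 ^ k)"
        using k i by (simp flip: power_add)
      have "real (2 ^ (n - i)) * (2 ^ k / 2 ^ n / c k * s) = s * (1 / (2 ^ (i - k) * c k))"
        unfolding n by simp
      also have "2 ^ (i - k) * c k = (4 / 3) ^ (i - k)"
        unfolding c_def by (simp flip: power_mult_distrib)
      also have "1 / (4 / 3 :: real) ^ (i - k) = (3 / 4) ^ (i - k)"
        by (simp add: power_divide)
      finally show ?thesis by simp
    qed
    finally show ?thesis by (simp add: c_def algebra_simps)
  qed
  \<comment> \<open>Agreement on the whole queried prefix keeps \<open>y\<close> on the same side of
    the cut, so only levels below \<open>i\<close> lose anything.\<close>
  have zero: "f k x y = 0" if "x \<in> A" "y \<in> inputs n - A" "\<not> k < i" for k x y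
  proof -
    have "\<not> agree k x y"
    proof
      assume "agree k x y"
      then have "agree i b y" using that by (auto simp: A_def agree_def)
      then show False using that by (auto simp: A_def)
    qed
    then show ?thesis by (simp add: f_def)
  qed
  have "(\<Sum>x\<in>A. \<Sum>y\<in>inputs n - A. weight n x y * D x y)
      = (\<Sum>x\<in>A. \<Sum>y\<in>inputs n - A. \<Sum>k<n. f k x y)"
    by (simp add: weight_def f_def sum_distrib_right)
  also have "\<dots> = (\<Sum>x\<in>A. \<Sum>k<n. \<Sum>y\<in>inputs n - A. f k x y)"
    by (intro sum.cong refl sum.swap)
  also have "\<dots> = (\<Sum>k<n. \<Sum>x\<in>A. \<Sum>y\<in>inputs n - A. f k x y)"
    by (rule sum.swap)
  also have "\<dots> = (\<Sum>k<i. \<Sum>x\<in>A. \<Sum>y\<in>inputs n - A. f k x y)"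
    using i zero by (intro sum.mono_neutral_right) auto
  also have "\<dots> \<le> (\<Sum>k<i. ((2 / 3) ^ (i - k) + (3 / 4) ^ (i - k)) * s)"
    by (intro sum_mono level) simp
  also have "\<dots> = ((\<Sum>k<i. (2 / 3) ^ (i - k)) + (\<Sum>k<i. (3 / 4) ^ (i - k))) * s"
    by (simp add: sum_distrib_right sum.distrib distrib_right)
  also have "\<dots> \<le> (2 + 3) * s"
    using sum_power_diff_le[of "2 / 3" i] sum_power_diff_le[of "3 / 4" i] s
    by (intro mult_right_mono add_mono) simp_all
  finally show ?thesis by (simp add: s_def)
qed

text \<open>Only pairs on opposite sides of the cut contribute, and each of the two orientations
  costs at most 5.\<close>

lemma sum_weight_separated_le:
  fixes N :: "(nat \<Rightarrow> int) \<Rightarrow> real" and D :: "(nat \<Rightarrow> int) \<Rightarrow> (nat \<Rightarrow> int) \<Rightarrow> real"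
  assumes i: "i \<in> {1..n}" and b: "\<And>j. j \<in> {1..i} \<Longrightarrow> b j \<in> {-1, 1}"
    and N: "\<And>x. 0 \<le> N x"
    and D: "\<And>x y c. c > 0 \<Longrightarrow> D x y \<le> c * N x + N y / c"
    and D0: "\<And>x y. agree i b x = agree i b y \<Longrightarrow> D x y = 0"
  shows "(\<Sum>x\<in>inputs n. \<Sum>y\<in>inputs n. weight n x y * D x y) \<le> 10 * (\<Sum>x\<in>inputs n. N x)"
proof -
  define A where "A = {x \<in> inputs n. agree i b x}"
  define I where "I = inputs n"
  define F where "F x y = weight n x y * D x y" for x y
  have A: "A \<subseteq> I" "finite I" by (auto simp: A_def I_def)
  have F0: "F x y = 0" if "x \<in> I" "y \<in> I" "x \<in> A \<longleftrightarrow> y \<in> A" for x y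
    using D0[of x y] that by (auto simp: A_def F_def I_def)
  have split: "(\<Sum>x\<in>I. h x) = (\<Sum>x\<in>I - A. h x) + (\<Sum>x\<in>A. h x)" for h :: "_ \<Rightarrow> real"
    using A by (rule sum.subset_diff)
  have "(\<Sum>x\<in>I. \<Sum>y\<in>I. F x y) = (\<Sum>x\<in>I - A. \<Sum>y\<in>I. F x y) + (\<Sum>x\<in>A. \<Sum>y\<in>I. F x y)"
    by (rule split)
  also have "(\<Sum>x\<in>I - A. \<Sum>y\<in>I. F x y) = (\<Sum>x\<in>I - A. \<Sum>y\<in>A. F x y)"
    using A F0 by (intro sum.cong sum.mono_neutral_right) auto
  also have "\<dots> = (\<Sum>x\<in>A. \<Sum>y\<in>I - A. weight n x y * D y x)"
    by (subst sum.swap) (simp add: F_def weight_sym)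
  also have "\<dots> \<le> 5 * (\<Sum>x\<in>inputs n. N x)"
    unfolding A_def I_def
  proof (rule sum_weight_cut_le[OF i b N])
    \<comment> \<open>Exchanging the two inputs replaces the AM-GM parameter \<open>c\<close> by
      \<open>1 / c\<close>.\<close>
    show "D y x \<le> c * N x + N y / c" if "c > 0" for x y and c :: real
      using D[of "1 / c" y x] that by (simp add: ac_simps)
  qed
  also have "(\<Sum>x\<in>A. \<Sum>y\<in>I. F x y) = (\<Sum>x\<in>A. \<Sum>y\<in>I - A. F x y)"
    using A F0 by (intro sum.cong sum.mono_neutral_right) auto
  also have "\<dots> \<le> 5 * (\<Sum>x\<in>inputs n. N x)"
    unfolding A_def I_def F_def by (rule sum_weight_cut_le[OF i b N D])
  finally show ?thesis by (simp add: F_def I_def)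
qed


section \<open>Quantum states and measurements\<close>

text \<open>Real parts suffice: the weights are symmetric, so imaginary parts cancel in the sum over
  ordered pairs.\<close>

definition re_inner :: "label set \<Rightarrow> state \<Rightarrow> state \<Rightarrow> real" where
  "re_inner B u v = (\<Sum>i\<in>B. Re (cnj (u i) * v i))"

lemma re_inner_eq: "re_inner B u v = Re (\<Sum>i\<in>B. cnj (u i) * v i)"
  by (simp add: re_inner_def Re_sum)

lemma re_inner_self: "re_inner B u u = (\<Sum>i\<in>B. (cmod (u i))\<^sup>2)"
  by (simp add: re_inner_def cmod_power2 flip: power2_eq_square)

lemma re_inner_sym: "re_inner B u v = re_inner B v u"
  by (simp add: re_inner_def mult.commute)

text \<open>States are functions on all labels, while equations such as \<open>apply_oracle\<close>
  hold on the basis only.\<close>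

lemma re_inner_cong:
  "(\<And>i. i \<in> B \<Longrightarrow> u i = u' i) \<Longrightarrow> (\<And>i. i \<in> B \<Longrightarrow> v i = v' i) \<Longrightarrow> re_inner B u v = re_inner B u' v'"
  by (simp add: re_inner_def)

lemma re_inner_unitary:
  assumes "finite B" and "unitary_mat B A"
  shows "re_inner B (apply_mat B A u) (apply_mat B A v) = re_inner B u v"
proof -
  have "(\<Sum>k\<in>B. cnj (apply_mat B A u k) * apply_mat B A v k)
      = (\<Sum>k\<in>B. \<Sum>i\<in>B. \<Sum>j\<in>B. cnj (u i) * v j * (cnj (A k i) * A k j))"
    unfolding apply_mat_def cnj_sum sum_product by (intro sum.cong refl) (simp add: ac_simps)
  also have "\<dots> = (\<Sum>i\<in>B. \<Sum>k\<in>B. \<Sum>j\<in>B. cnj (u i) * v j * (cnj (A k i) * A k j))"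
    by (rule sum.swap)
  also have "\<dots> = (\<Sum>i\<in>B. \<Sum>j\<in>B. \<Sum>k\<in>B. cnj (u i) * v j * (cnj (A k i) * A k j))"
    by (intro sum.cong refl sum.swap)
  also have "\<dots> = (\<Sum>i\<in>B. \<Sum>j\<in>B. cnj (u i) * v j * of_bool (i = j))"
    using assms(2) by (simp add: unitary_mat_def flip: sum_distrib_left)
  also have "\<dots> = (\<Sum>i\<in>B. cnj (u i) * v i)"
    using assms(1) by (simp add: of_bool_def if_distrib[of "(*) _"] cong: if_cong)
  finally show ?thesis by (simp only: re_inner_eq)
qed

section \<open>Measurements that distinguish two states\<close>

definition sesq :: "label set \<Rightarrow> matrix \<Rightarrow> state \<Rightarrow> state \<Rightarrow> complex" where
  "sesq B A u v = (\<Sum>i\<in>B. \<Sum>j\<in>B. cnj (u i) * A i j * v j)"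

text \<open>With real coefficients the cross terms appear symmetrised, so nonnegativity of the left
  side bounds them directly: a Cauchy-Schwarz inequality for one measurement effect.\<close>

lemma quad_form_diff:
  fixes a b :: real
  shows "quad_form B A (\<lambda>i. of_real a * u i - of_real b * v i)
    = of_real (a\<^sup>2) * quad_form B A u + of_real (b\<^sup>2) * quad_form B A v
      - of_real (a * b) * (sesq B A u v + sesq B A v u)"
  unfolding quad_form_def sesq_def sum_distrib_left sum.distrib[symmetric] sum_subtractf[symmetric]
  by (intro sum.cong refl) (simp add: algebra_simps power2_eq_square)

lemma sum_sesq_povm:
  assumes "finite B" and "povm B E M"
  shows "(\<Sum>e\<in>E. sesq B (M e) u v) = (\<Sum>i\<in>B. cnj (u i) * v i)"
proof -
  have "(\<Sum>e\<in>E. sesq B (M e) u v) = (\<Sum>i\<in>B. \<Sum>e\<in>E. \<Sum>j\<in>B. cnj (u i) * M e i j * v j)"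
    unfolding sesq_def by (rule sum.swap)
  also have "\<dots> = (\<Sum>i\<in>B. \<Sum>j\<in>B. \<Sum>e\<in>E. cnj (u i) * M e i j * v j)"
    by (intro sum.cong refl sum.swap)
  also have "\<dots> = (\<Sum>i\<in>B. \<Sum>j\<in>B. cnj (u i) * (\<Sum>e\<in>E. M e i j) * v j)"
    by (simp only: sum_distrib_left sum_distrib_right)
  also have "\<dots> = (\<Sum>i\<in>B. \<Sum>j\<in>B. cnj (u i) * of_bool (i = j) * v j)"
    using assms(2) by (simp add: povm_def)
  also have "\<dots> = (\<Sum>i\<in>B. cnj (u i) * v i)"
    using assms(1) by (simp add: of_bool_def if_distrib[of "(*) _"] if_distrib[of "\<lambda>c. c * _"] cong: if_cong)
  finally show ?thesis .
qed

text \<open>The overlap splits over the two outcomes, and each part is bounded by probabilities with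
  coefficients 4 and 9, the larger one on the unlikely outcome. Together, 12 times the overlap is at
  most 18 - 5 * (2/3 + 2/3), which gives 17/18, just above the optimum 2 * sqrt 2 / 3.\<close>

lemma overlap_le_of_distinguishable:
  assumes B: "finite B" and M: "povm B {e, e'} M" and ee': "e \<noteq> e'"
    and u: "re_inner B u u = 1" and v: "re_inner B v v = 1"
    and pu: "outcome_prob B M u e \<ge> 2 / 3" and pv: "outcome_prob B M v e' \<ge> 2 / 3"
  shows "re_inner B u v \<le> 17 / 18"
proof -
  have total: "outcome_prob B M w e + outcome_prob B M w e' = re_inner B w w" for w
    using arg_cong[OF sum_sesq_povm[OF B M, of w w], of Re] ee'
    by (simp add: outcome_prob_def quad_form_def sesq_def re_inner_eq)
  have cross: "a * b * Re (sesq B (M f) u v + sesq B (M f) v u)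
      \<le> a\<^sup>2 * outcome_prob B M u f + b\<^sup>2 * outcome_prob B M v f" if "f \<in> {e, e'}" for a b f
  proof -
    have "quad_form B (M f) (\<lambda>i. of_real a * u i - of_real b * v i) \<in> \<real>\<^sub>\<ge>\<^sub>0"
      using M that unfolding povm_def by blast
    then have "0 \<le> Re (quad_form B (M f) (\<lambda>i. of_real a * u i - of_real b * v i))"
      by (simp add: complex_nonneg_Reals_iff)
    then show ?thesis
      unfolding quad_form_diff outcome_prob_def by simp
  qed
  have "2 * re_inner B u v = Re (\<Sum>f\<in>{e, e'}. sesq B (M f) u v) + Re (\<Sum>f\<in>{e, e'}. sesq B (M f) v u)"
    unfolding sum_sesq_povm[OF B M] using re_inner_sym[of B u v] by (simp only: re_inner_eq)
  also have "\<dots> = Re (sesq B (M e) u v + sesq B (M e) v u) + Re (sesq B (M e') u v + sesq B (M e') v u)"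
    using ee' by simp
  \<comment> \<open>Cauchy--Schwarz as AM-GM: \<open>2 : 3\<close> approximates the optimal ratio
    \<open>sqrt (1 / 3) : sqrt (2 / 3)\<close>.\<close>
  finally show ?thesis
    using cross[of e 2 3] cross[of e' 3 2] total[of u] total[of v] u v pu pv by simp
qed

section \<open>Queries\<close>

definition slots :: "nat \<Rightarrow> (nat \<times> nat) set" where
  "slots d = {0, 1} \<times> {..<d}"

fun shift :: "nat \<Rightarrow> nat \<times> nat \<Rightarrow> nat \<times> nat" where
  "shift e (a, w) = ((a + e) mod 2, w)"

lemma basis_eq: "basis \<Q> d = queries \<Q> \<times> slots d"
  by (simp add: basis_def slots_def)

lemma finite_slots [simp]: "finite (slots d)"
  by (simp add: slots_def)

lemma oracle_map_eq: "oracle_map x (q, r) = (q, shift (answer x q) r)"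
  by (cases r) simp

lemma answer_cases: "answer x q \<in> {0, 1}"
  by (cases q) simp

lemma shift_in_slots: "r \<in> slots d \<Longrightarrow> shift e r \<in> slots d"
  by (cases r) (auto simp: slots_def)

lemma shift_shift: "r \<in> slots d \<Longrightarrow> e \<in> {0, 1} \<Longrightarrow> shift e (shift e r) = r"
  by (cases r) (auto simp: slots_def)

lemma sum_shift:
  assumes "e \<in> {0, 1}"
  shows "(\<Sum>r\<in>slots d. g (shift e r)) = (\<Sum>r\<in>slots d. g r)"
  by (rule sum.reindex_bij_witness[of _ "shift e" "shift e"])
    (simp_all add: shift_in_slots shift_shift[OF _ assms])

lemma oracle_map_in_basis: "i \<in> basis \<Q> d \<Longrightarrow> oracle_map x i \<in> basis \<Q> d"
  by (cases i rule: prod.exhaust) (simp add: basis_eq oracle_map_eq shift_in_slots)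

lemma oracle_map_involution: "i \<in> basis \<Q> d \<Longrightarrow> oracle_map x (oracle_map x i) = i"
  using shift_shift[OF _ answer_cases, of "snd i" d x "fst i"]
  by (cases i rule: prod.exhaust) (simp add: basis_eq oracle_map_eq)

text \<open>\<open>oracle_map x\<close> is an involution of the basis, so its permutation matrix
  composes a state with the map itself instead of an inverse.\<close>

lemma apply_oracle:
  assumes "finite (basis \<Q> d)" and "i \<in> basis \<Q> d"
  shows "apply_mat (basis \<Q> d) (oracle_mat x) v i = v (oracle_map x i)"
proof -
  have "apply_mat (basis \<Q> d) (oracle_mat x) v i = (\<Sum>j\<in>basis \<Q> d. of_bool (j = oracle_map x i) * v j)"
    unfolding apply_mat_def oracle_mat_def
  proof (intro sum.cong refl)
    fix j assume "j \<in> basis \<Q> d"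
    then have "i = oracle_map x j \<longleftrightarrow> j = oracle_map x i"
      using oracle_map_involution assms(2) by metis
    then show "of_bool (i = oracle_map x j) * v j = of_bool (j = oracle_map x i) * v j" by simp
  qed
  also have "\<dots> = v (oracle_map x i)"
    using assms oracle_map_in_basis[OF assms(2), of x]
    by (simp add: of_bool_def if_distrib[of "\<lambda>c. c * _"] cong: if_cong)
  finally show ?thesis .
qed

section \<open>Overlap carried by a single query\<close>

definition slice :: "nat \<Rightarrow> query \<Rightarrow> state \<Rightarrow> state \<Rightarrow> real" where
  "slice d q u v = (\<Sum>r\<in>slots d. Re (cnj (u (q, r)) * v (q, r)))"

lemma re_inner_slices: "re_inner (basis \<Q> d) u v = (\<Sum>q\<in>queries \<Q>. slice d q u v)"
  by (simp add: re_inner_def slice_def basis_eq sum.cartesian_product)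

lemma slice_self_nonneg: "0 \<le> slice d q u u"
  by (simp add: slice_def sum_nonneg)

text \<open>Cauchy-Schwarz followed by AM-GM. The parameter \<open>c\<close> stays free so that it
  can be chosen separately at each level of the weights.\<close>

lemma abs_slice_le:
  assumes "c > 0"
  shows "\<bar>slice d q u v\<bar> \<le> (c * slice d q u u + slice d q v v / c) / 2"
proof -
  have pointwise: "\<bar>Re (cnj z * w)\<bar> \<le> (c * Re (cnj z * z) + Re (cnj w * w) / c) / 2" for z w :: complex
  proof -
    have sq: "Re (cnj y * y) = (cmod y)\<^sup>2" for y
      by (simp add: cmod_power2 flip: power2_eq_square)
    have "\<bar>Re (cnj z * w)\<bar> \<le> cmod z * cmod w"
      using abs_Re_le_cmod[of "cnj z * w"] by (simp add: norm_mult)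
    also have "\<dots> \<le> (c * (cmod z)\<^sup>2 + (cmod w)\<^sup>2 / c) / 2"
    proof -
      have "0 \<le> (c * cmod z - cmod w)\<^sup>2 / c" using assms by simp
      also have "\<dots> = c * (cmod z)\<^sup>2 + (cmod w)\<^sup>2 / c - 2 * (cmod z * cmod w)"
        using assms by (simp add: field_simps power2_eq_square)
      finally show ?thesis by simp
    qed
    finally show ?thesis unfolding sq .
  qed
  have "\<bar>slice d q u v\<bar> \<le> (\<Sum>r\<in>slots d. \<bar>Re (cnj (u (q, r)) * v (q, r))\<bar>)"
    unfolding slice_def by (rule sum_abs)
  also have "\<dots> \<le> (\<Sum>r\<in>slots d. (c * Re (cnj (u (q, r)) * u (q, r))
      + Re (cnj (v (q, r)) * v (q, r)) / c) / 2)"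
    by (intro sum_mono pointwise)
  also have "\<dots> = (c * slice d q u u + slice d q v v / c) / 2"
    unfolding slice_def
    by (simp only: sum_divide_distrib[symmetric] sum.distrib sum_distrib_left[symmetric])
  finally show ?thesis .
qed

text \<open>Equal answers shift the answer qubit of both states alike. With \<open>x = y\<close>
  this says that the oracle preserves the norm on each query.\<close>

lemma slice_oracle:
  assumes "answer x q = answer y q"
  shows "slice d q (\<lambda>i. u (oracle_map x i)) (\<lambda>i. v (oracle_map y i)) = slice d q u v"
  unfolding slice_def oracle_map_eq assms
  by (rule sum_shift[OF answer_cases, where g = "\<lambda>r. Re (cnj (u (q, r)) * v (q, r))"])

text \<open>The overlaps before and after the query are each at most half of the right side, since
  the oracle preserves both norms.\<close>

lemma slice_change_le:
  assumes "c > 0"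
  shows "slice d q u v - slice d q (\<lambda>i. u (oracle_map x i)) (\<lambda>i. v (oracle_map y i))
    \<le> c * slice d q u u + slice d q v v / c"
  using abs_slice_le[OF assms, of d q u v]
    abs_slice_le[OF assms, of d q "\<lambda>i. u (oracle_map x i)" "\<lambda>i. v (oracle_map y i)"]
    slice_oracle[of x q x d u u] slice_oracle[of y q y d v v]
  by (simp add: field_simps)

lemma finite_queries [simp]: "finite (queries (prefix_sets n))"
  by (auto simp: queries_def prefix_sets_def intro!: finite_PiE)

lemma finite_basis [simp]: "finite (basis (prefix_sets n) d)"
  by (simp add: basis_eq)

text \<open>Both \<open>b\<close> and the restricted input are extensional, so their equality
  amounts to agreement on the prefix.\<close>

lemma queriesE:
  assumes "q \<in> queries (prefix_sets n)"
  obtains i b where "i \<in> {1..n}" "\<And>j. j \<in> {1..i} \<Longrightarrow> b j \<in> {-1, 1}"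
    "\<And>x. answer x q = of_bool (agree i b x)"
proof -
  obtain i b where i: "i \<in> {1..n}" and q: "q = ({1..i}, b)" and b: "b \<in> {1..i} \<rightarrow>\<^sub>E {-1, 1}"
    using assms by (auto simp: queries_def prefix_sets_def)
  have "restrict x {1..i} = b \<longleftrightarrow> agree i b x" for x
  proof
    show "agree i b x" if "restrict x {1..i} = b"
      unfolding that[symmetric] agree_def by simp
    show "restrict x {1..i} = b" if "agree i b x"
      using that PiE_arb[OF b] by (intro ext) (simp add: agree_def restrict_def)
  qed
  then show thesis
    using that[OF i, of b] PiE_mem[OF b] unfolding q by simp
qed

section \<open>Lower bound\<close>

locale query_algorithm =
  fixes n d T :: nat and \<psi> :: state and U :: "nat \<Rightarrow> matrix"
  assumes unit: "unit_state (basis (prefix_sets n) d) \<psi>"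
    and unitary: "\<And>t. t \<le> T \<Longrightarrow> unitary_mat (basis (prefix_sets n) d) (U t)"
begin

abbreviation "B \<equiv> basis (prefix_sets n) d"
abbreviation "st x t \<equiv> final_state B \<psi> U x t"

lemma re_inner_start: "re_inner B (st x 0) (st y 0) = 1"
proof -
  have "re_inner B (st x 0) (st y 0) = re_inner B \<psi> \<psi>"
    using unitary[of 0] by (simp add: re_inner_unitary)
  then show ?thesis using unit by (simp add: re_inner_self unit_state_def)
qed

text \<open>The unitary after the query preserves overlaps; what remains is the effect of the
  oracle, one query at a time.\<close>

lemma re_inner_step:
  assumes "Suc t \<le> T"
  shows "re_inner B (st x (Suc t)) (st y (Suc t))
    = (\<Sum>q\<in>queries (prefix_sets n).
        slice d q (\<lambda>i. st x t (oracle_map x i)) (\<lambda>i. st y t (oracle_map y i)))"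
  unfolding final_state.simps re_inner_unitary[OF finite_basis unitary[OF assms]] re_inner_slices[symmetric]
  by (intro re_inner_cong apply_oracle finite_basis)

lemma re_inner_state_self: "t \<le> T \<Longrightarrow> re_inner B (st x t) (st x t) = 1"
proof (induction t)
  case 0
  show ?case by (rule re_inner_start)
next
  case (Suc t)
  then show ?case
    by (simp add: re_inner_step slice_oracle re_inner_slices[symmetric] del: final_state.simps)
qed

text \<open>The progress function of the adversary method, summed over ordered pairs.\<close>

definition progress :: "nat \<Rightarrow> real" where
  "progress t = (\<Sum>x\<in>inputs n. \<Sum>y\<in>inputs n. weight n x y * re_inner B (st x t) (st y t))"

lemma progress_0: "progress 0 = 2 ^ n * (real n / 2)"
proof -
  have "progress 0 = (\<Sum>x\<in>inputs n. \<Sum>y\<in>inputs n. weight n x y)"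
    unfolding progress_def by (simp only: re_inner_start mult_1_right)
  then show ?thesis by (simp add: sum_weight card_inputs)
qed

text \<open>Each query \<open>q\<close> loses at most 10 times the squared norm placed on it, summed
  over all inputs. Over all \<open>q\<close> these squared norms add up to 1 for every input, and
  there are 2^n inputs.\<close>

lemma progress_step:
  assumes t: "Suc t \<le> T"
  shows "progress t - progress (Suc t) \<le> 10 * 2 ^ n"
proof -
  define D where "D q x y = slice d q (st x t) (st y t)
    - slice d q (\<lambda>i. st x t (oracle_map x i)) (\<lambda>i. st y t (oracle_map y i))" for q x y
  let ?Q = "queries (prefix_sets n)"
  have "progress t - progress (Suc t) = (\<Sum>x\<in>inputs n. \<Sum>y\<in>inputs n. \<Sum>q\<in>?Q. weight n x y * D q x y)"
    unfolding progress_def re_inner_step[OF t] unfolding re_inner_slices D_def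
    by (simp only: sum_subtractf[symmetric] right_diff_distrib[symmetric] sum_distrib_left[symmetric])
  also have "\<dots> = (\<Sum>x\<in>inputs n. \<Sum>q\<in>?Q. \<Sum>y\<in>inputs n. weight n x y * D q x y)"
    by (intro sum.cong refl sum.swap)
  also have "\<dots> = (\<Sum>q\<in>?Q. \<Sum>x\<in>inputs n. \<Sum>y\<in>inputs n. weight n x y * D q x y)"
    by (rule sum.swap)
  also have "\<dots> \<le> (\<Sum>q\<in>?Q. 10 * (\<Sum>x\<in>inputs n. slice d q (st x t) (st x t)))"
  proof (intro sum_mono)
    fix q assume "q \<in> ?Q"
    then obtain i b where ib: "i \<in> {1..n}" "\<And>j. j \<in> {1..i} \<Longrightarrow> b j \<in> {-1, 1}"
      and ans: "\<And>x. answer x q = of_bool (agree i b x)"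
      by (rule queriesE) blast
    show "(\<Sum>x\<in>inputs n. \<Sum>y\<in>inputs n. weight n x y * D q x y)
        \<le> 10 * (\<Sum>x\<in>inputs n. slice d q (st x t) (st x t))"
    proof (rule sum_weight_separated_le[OF ib slice_self_nonneg])
      show "D q x y \<le> c * slice d q (st x t) (st x t) + slice d q (st y t) (st y t) / c"
        if "c > 0" for x y and c :: real
        unfolding D_def by (rule slice_change_le[OF that])
      show "D q x y = 0" if "agree i b x = agree i b y" for x y
        unfolding D_def using that by (simp add: slice_oracle ans)
    qed
  qed
  also have "\<dots> = 10 * (\<Sum>x\<in>inputs n. re_inner B (st x t) (st x t))"
    unfolding re_inner_slices sum_distrib_left[symmetric] by (subst sum.swap) (rule refl)
  also have "\<dots> = 10 * 2 ^ n"
    using t by (simp add: re_inner_state_self card_inputs)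
  finally show ?thesis .
qed

lemma progress_ge: "t \<le> T \<Longrightarrow> progress 0 - progress t \<le> real t * (10 * 2 ^ n)"
proof (induction t)
  case (Suc t)
  then show ?case using progress_step[of t] by (simp add: algebra_simps)
qed simp

lemma query_bound:
  assumes M: "povm B {-1, 1} M" and n: "n \<ge> 1"
    and correct: "\<And>x. x \<in> inputs n \<Longrightarrow> outcome_prob B M (st x T) (x n) \<ge> 2 / 3"
  shows "real n \<le> 360 * real T"
proof -
  have "weight n x y * re_inner B (st x T) (st y T) \<le> weight n x y * (17 / 18)"
    if xy: "x \<in> inputs n" "y \<in> inputs n" for x y
  proof (cases "x n = y n")
    case False
    then have "{x n, y n} = {-1, 1}"
      using inputs_memD[OF xy(1), of n] inputs_memD[OF xy(2), of n] n by auto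
    then have "povm B {x n, y n} M" using M by simp
    from overlap_le_of_distinguishable[OF finite_basis this False re_inner_state_self[OF le_refl]
        re_inner_state_self[OF le_refl] correct[OF xy(1)] correct[OF xy(2)]]
    have "re_inner B (st x T) (st y T) \<le> 17 / 18" .
    then show ?thesis by (intro mult_left_mono weight_nonneg)
  qed (simp add: weight_eq_0)
  then have "progress T \<le> (\<Sum>x\<in>inputs n. \<Sum>y\<in>inputs n. weight n x y * (17 / 18))"
    unfolding progress_def by (intro sum_mono)
  also have "\<dots> = 17 / 36 * (2 ^ n * real n)"
    by (simp add: sum_weight card_inputs sum_distrib_right[symmetric] del: times_divide_eq_right)
  finally have "progress T \<le> 17 / 36 * (2 ^ n * real n)" .
  moreover have "progress 0 - progress T \<le> 10 * (2 ^ n * real T)"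
    using progress_ge[OF le_refl] by (simp add: ac_simps)
  moreover have "progress 0 = 1 / 2 * (2 ^ n * real n)"
    by (simp add: progress_0)
  \<comment> \<open>A share 1/2 - 17/36 = 1/36 of 2^n * n must be lost at a rate of at most 10 * 2^n
    per query, whence 360.\<close>
  ultimately have "2 ^ n * real n \<le> 360 * (2 ^ n * real T)"
    by linarith
  then show ?thesis by (simp add: mult.left_commute[of 360])
qed

end

lemma quantum_computable_Dict_lower:
  assumes "n \<ge> 1" and "quantum_computable n (prefix_sets n) {-1, 1} (Dict n) T"
  shows "real n \<le> 360 * real T"
proof -
  obtain d \<psi> U M where alg: "unit_state (basis (prefix_sets n) d) \<psi>"
      "\<And>t. t \<le> T \<Longrightarrow> unitary_mat (basis (prefix_sets n) d) (U t)"
    and M: "povm (basis (prefix_sets n) d) {-1, 1} M"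
    and correct: "\<And>x. x \<in> inputs n \<Longrightarrow>
      outcome_prob (basis (prefix_sets n) d) M (final_state (basis (prefix_sets n) d) \<psi> U x T) (x n) \<ge> 2 / 3"
    using assms(2) unfolding quantum_computable_def Dict_def by blast
  interpret query_algorithm n d T \<psi> U
    using alg by unfold_locales
  show ?thesis by (rule query_bound[OF M assms(1) correct])
qed


section \<open>Upper bound\<close>

definition perm_mat :: "(label \<Rightarrow> label) \<Rightarrow> matrix" where
  "perm_mat \<pi> i j = of_bool (i = \<pi> j)"

definition ket :: "label \<Rightarrow> state" where
  "ket b i = of_bool (i = b)"

lemma unitary_perm_mat:
  assumes "finite B" and \<pi>: "bij_betw \<pi> B B"
  shows "unitary_mat B (perm_mat \<pi>)"
proof -
  have "(\<Sum>k\<in>B. cnj (perm_mat \<pi> k i) * perm_mat \<pi> k j) = of_bool (i = j)"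
    if "i \<in> B" "j \<in> B" for i j
  proof -
    have "(\<Sum>k\<in>B. cnj (perm_mat \<pi> k i) * perm_mat \<pi> k j) = (\<Sum>k\<in>B. if k = \<pi> i then of_bool (\<pi> i = \<pi> j) else 0)"
      by (intro sum.cong refl) (auto simp: perm_mat_def)
    also have "\<dots> = of_bool (i = j)"
      using assms(1) that bij_betwE[OF \<pi>] inj_on_eq_iff[OF bij_betw_imp_inj_on[OF \<pi>]] by simp
    finally show ?thesis .
  qed
  moreover have "(\<Sum>k\<in>B. perm_mat \<pi> i k * cnj (perm_mat \<pi> j k)) = of_bool (i = j)"
    if "i \<in> B" "j \<in> B" for i j
  proof -
    have "(\<Sum>k\<in>B. perm_mat \<pi> i k * cnj (perm_mat \<pi> j k)) = (\<Sum>k\<in>B. (\<lambda>l. if l = i then of_bool (i = j) else 0) (\<pi> k))"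
      by (intro sum.cong refl) (auto simp: perm_mat_def)
    also have "\<dots> = (\<Sum>k\<in>B. if k = i then of_bool (i = j) else 0)"
      by (rule sum.reindex_bij_betw[OF \<pi>])
    finally show ?thesis using assms(1) that by simp
  qed
  ultimately show ?thesis by (simp add: unitary_mat_def)
qed

lemma apply_mat_ket:
  assumes "finite B" and "b \<in> B"
  shows "apply_mat B A (ket b) = (\<lambda>i. A i b)"
  using assms by (simp add: apply_mat_def ket_def of_bool_def if_distrib[of "(*) _"] cong: if_cong)

text \<open>By \<open>fg\<close>, sending \<open>f x\<close> to \<open>g x\<close> is well defined
  and injective. The complements of the two images in the finite set \<open>B\<close> have equal
  size, so any bijection between them completes the permutation.\<close>

lemma extend_to_permutation:
  assumes "finite B" and f: "f ` X \<subseteq> B" and g: "g ` X \<subseteq> B"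
    and fg: "\<And>x y. x \<in> X \<Longrightarrow> y \<in> X \<Longrightarrow> f x = f y \<longleftrightarrow> g x = g y"
  shows "\<exists>\<pi>. bij_betw \<pi> B B \<and> (\<forall>x\<in>X. \<pi> (f x) = g x)"
proof -
  define h where "h b = g (inv_into X f b)" for b
  have h: "h (f x) = g x" if "x \<in> X" for x
    unfolding h_def using that fg[of "inv_into X f (f x)" x]
    by (simp add: f_inv_into_f inv_into_into)
  have hb: "bij_betw h (f ` X) (g ` X)"
    unfolding bij_betw_def inj_on_def using h fg by (auto simp: image_iff)
  have "card (B - f ` X) = card (B - g ` X)"
    using assms(1) f g bij_betw_same_card[OF hb] by (simp add: card_Diff_subset finite_subset)
  then obtain k where k: "bij_betw k (B - f ` X) (B - g ` X)"
    using assms(1) by (meson finite_Diff finite_same_card_bij)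
  define \<pi> where "\<pi> b = (if b \<in> f ` X then h b else k b)" for b
  have "bij_betw \<pi> (f ` X \<union> (B - f ` X)) (g ` X \<union> (B - g ` X))"
  proof (rule bij_betw_combine)
    show "bij_betw \<pi> (f ` X) (g ` X)"
      using hb by (rule bij_betw_cong[THEN iffD1, rotated]) (simp add: \<pi>_def)
    show "bij_betw \<pi> (B - f ` X) (B - g ` X)"
      using k by (rule bij_betw_cong[THEN iffD1, rotated]) (simp add: \<pi>_def)
  qed auto
  moreover have "f ` X \<union> (B - f ` X) = B" "g ` X \<union> (B - g ` X) = B"
    using f g by auto
  ultimately show ?thesis using h by (auto simp: \<pi>_def)
qed

text \<open>\<open>pre t x\<close> is the basis label reached after \<open>t\<close> queries and the
  unitary that follows them. By \<open>step\<close>, the label after the next query and the label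
  \<open>pre (Suc t) x\<close> determine each other, so one permutation independent of
  \<open>x\<close> links them. The resulting algorithm never errs.\<close>

lemma quantum_computable_reversible:
  fixes pre :: "nat \<Rightarrow> (nat \<Rightarrow> int) \<Rightarrow> label"
  assumes fin: "finite (basis \<Q> d)" and E: "finite E"
    and start: "s \<in> basis \<Q> d" "\<And>x. x \<in> inputs n \<Longrightarrow> pre 0 x = s"
    and pre: "\<And>t x. t \<le> T \<Longrightarrow> x \<in> inputs n \<Longrightarrow> pre t x \<in> basis \<Q> d"
    and step: "\<And>t x y. t < T \<Longrightarrow> x \<in> inputs n \<Longrightarrow> y \<in> inputs n \<Longrightarrow>
      oracle_map x (pre t x) = oracle_map y (pre t y) \<longleftrightarrow> pre (Suc t) x = pre (Suc t) y"
    and out: "\<And>i. i \<in> basis \<Q> d \<Longrightarrow> out i \<in> E"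
    and correct: "\<And>x. x \<in> inputs n \<Longrightarrow> out (pre T x) = F x"
  shows "quantum_computable n \<Q> E F T"
proof -
  let ?B = "basis \<Q> d"
  have "\<exists>\<pi>. bij_betw \<pi> ?B ?B \<and> (\<forall>x\<in>inputs n. \<pi> (oracle_map x (pre t x)) = pre (Suc t) x)" if "t < T" for t
  proof (rule extend_to_permutation[OF fin])
    show "(\<lambda>x. oracle_map x (pre t x)) ` inputs n \<subseteq> ?B"
      using that by (auto intro!: oracle_map_in_basis pre simp del: oracle_map.simps)
    show "pre (Suc t) ` inputs n \<subseteq> ?B"
      using that by (auto intro!: pre)
  qed (rule step[OF that])
  then obtain \<pi> where \<pi>: "\<And>t. t < T \<Longrightarrow> bij_betw (\<pi> t) ?B ?B"
    "\<And>t x. t < T \<Longrightarrow> x \<in> inputs n \<Longrightarrow> \<pi> t (oracle_map x (pre t x)) = pre (Suc t) x"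
    by metis
  \<comment> \<open>The start vector is already \<open>ket s\<close>, so \<open>U 0\<close> is the
    identity; \<open>U (Suc t)\<close> follows the query made from \<open>pre t x\<close>.\<close>
  define U where "U t = perm_mat (case t of 0 \<Rightarrow> id | Suc t \<Rightarrow> \<pi> t)" for t
  \<comment> \<open>Measurement in the standard basis, with \<open>out\<close> read off the label
    found.\<close>
  define M :: "_ \<Rightarrow> matrix" where "M e i j = of_bool (i = j \<and> out i = e)" for e i j
  have quad: "quad_form ?B (M e) v = of_real (\<Sum>i\<in>?B. of_bool (out i = e) * (cmod (v i))\<^sup>2)" for e v
  proof -
    have "quad_form ?B (M e) v = (\<Sum>i\<in>?B. \<Sum>j\<in>?B. if j = i then cnj (v i) * of_bool (out i = e) * v i else 0)"
      unfolding quad_form_def M_def by (intro sum.cong refl) auto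
    also have "\<dots> = (\<Sum>i\<in>?B. of_real (of_bool (out i = e) * (cmod (v i))\<^sup>2))"
    proof (intro sum.cong refl)
      fix i assume "i \<in> ?B"
      then show "(\<Sum>j\<in>?B. if j = i then cnj (v i) * of_bool (out i = e) * v i else 0)
          = of_real (of_bool (out i = e) * (cmod (v i))\<^sup>2)"
        using fin by (simp add: complex_norm_square mult.commute del: of_real_power)
    qed
    finally show ?thesis by simp
  qed
  have state: "final_state ?B (ket s) U x t = ket (pre t x)" if "t \<le> T" "x \<in> inputs n" for t x
    using that(1)
  proof (induction t)
    case 0
    show ?case
      using start that(2) fin by (simp add: apply_mat_ket U_def) (simp add: perm_mat_def ket_def fun_eq_iff)
  next
    case (Suc t)
    have "apply_mat ?B (oracle_mat x) (ket (pre t x)) = ket (oracle_map x (pre t x))"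
      using Suc.prems that(2) pre[of t x] fin by (simp add: apply_mat_ket oracle_mat_def ket_def fun_eq_iff)
    moreover have "apply_mat ?B (U (Suc t)) (ket (oracle_map x (pre t x))) = ket (pre (Suc t) x)"
    proof -
      have "oracle_map x (pre t x) \<in> ?B"
        using Suc.prems that(2) by (intro oracle_map_in_basis pre) simp_all
      then show ?thesis
        using Suc.prems that(2) fin \<pi>(2)[of t x]
        by (simp add: apply_mat_ket U_def perm_mat_def ket_def fun_eq_iff)
    qed
    ultimately show ?case using Suc by simp
  qed
  have ket_sum: "(\<Sum>i\<in>?B. g i * (cmod (ket b i))\<^sup>2) = g b" if "b \<in> ?B" for g :: "_ \<Rightarrow> real" and b
  proof -
    have "(\<Sum>i\<in>?B. g i * (cmod (ket b i))\<^sup>2) = (\<Sum>i\<in>?B. if i = b then g b else 0)"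
      by (intro sum.cong refl) (auto simp: ket_def)
    then show ?thesis using fin that by simp
  qed
  show ?thesis
    unfolding quantum_computable_def
  proof (intro exI[of _ d] exI[of _ "ket s"] exI[of _ U] exI[of _ M] conjI allI impI ballI)
    show "unit_state ?B (ket s)"
      using ket_sum[OF start(1), of "\<lambda>_. 1"] by (simp add: unit_state_def)
    show "unitary_mat ?B (U t)" if "t \<le> T" for t
      unfolding U_def using that \<pi>(1) by (intro unitary_perm_mat fin) (auto split: nat.split)
    show "povm ?B E M"
      unfolding povm_def
    proof (intro conjI ballI allI E)
      show "quad_form ?B (M e) v \<in> \<real>\<^sub>\<ge>\<^sub>0" for e v
        unfolding quad by (simp add: sum_nonneg del: of_real_sum)
      show "(\<Sum>e\<in>E. M e i j) = of_bool (i = j)" if "i \<in> ?B" for i j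
        using E out[OF that] by (cases "i = j") (simp_all add: M_def of_bool_def)
    qed
    show "2 / 3 \<le> outcome_prob ?B M (final_state ?B (ket s) U x T) (F x)" if "x \<in> inputs n" for x
      using that pre[of T x] correct[of x] by (simp add: outcome_prob_def quad state ket_sum)
  qed
qed

section \<open>Learning the bits one at a time\<close>

lemma prefix_guess_eq_iff:
  fixes x y :: "nat \<Rightarrow> int"
  shows "restrict (x(Suc t := 1)) {1..Suc t} = restrict (y(Suc t := 1)) {1..Suc t} \<longleftrightarrow> agree t x y"
proof
  assume eq: "restrict (x(Suc t := 1)) {1..Suc t} = restrict (y(Suc t := 1)) {1..Suc t}"
  have "x j = y j" if "j \<in> {1..t}" for j
    using fun_cong[OF eq, of j] that by simp
  then show "agree t x y" by (simp add: agree_def)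
qed (auto simp: agree_def restrict_def)

lemma agree_Suc: "agree (Suc t) x y \<longleftrightarrow> agree t x y \<and> x (Suc t) = y (Suc t)"
  by (auto simp: agree_def atLeastAtMostSuc_conv)

lemma quantum_computable_Dict_upper:
  assumes "n \<ge> 1"
  shows "quantum_computable n (prefix_sets n) {-1, 1} (Dict n) n"
proof -
  define guess :: "nat \<Rightarrow> (nat \<Rightarrow> int) \<Rightarrow> label" where
    "guess t x = (({1..Suc t}, restrict (x(Suc t := 1)) {1..Suc t}), 0, 0)" for t x
  \<comment> \<open>After \<open>n\<close> queries there is no longer prefix to ask about: the last
    label is kept as the oracle left it, with the answer qubit telling whether
    \<open>x n = 1\<close>.\<close>
  define pre where "pre t x = (if t < n then guess t x else oracle_map x (guess (n - 1) x))" for t x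
  let ?B = "basis (prefix_sets n) 1"
  have oracle_guess: "oracle_map x (guess t x)
      = (({1..Suc t}, restrict (x(Suc t := 1)) {1..Suc t}), of_bool (x (Suc t) = 1), 0)" for t x
  proof -
    have "restrict x {1..Suc t} = restrict (x(Suc t := 1)) {1..Suc t} \<longleftrightarrow> x (Suc t) = 1"
    proof
      assume "restrict x {1..Suc t} = restrict (x(Suc t := 1)) {1..Suc t}"
      from fun_cong[OF this, of "Suc t"] show "x (Suc t) = 1" by simp
    next
      assume "x (Suc t) = 1"
      then have "x(Suc t := 1) = x" by (simp add: fun_upd_idem)
      then show "restrict x {1..Suc t} = restrict (x(Suc t := 1)) {1..Suc t}" by simp
    qed
    then show ?thesis by (simp add: guess_def)
  qed
  have guess_in: "guess t x \<in> ?B" if "t < n" "x \<in> inputs n" for t x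
  proof -
    have "{1..Suc t} \<in> prefix_sets n" using that(1) by (auto simp: prefix_sets_def)
    moreover have "restrict (x(Suc t := 1)) {1..Suc t} \<in> {1..Suc t} \<rightarrow>\<^sub>E {-1, 1}"
    proof (rule restrict_PiE_iff[THEN iffD2], rule ballI)
      show "(x(Suc t := 1)) j \<in> {-1, 1}" if "j \<in> {1..Suc t}" for j
        using that \<open>t < n\<close> inputs_memD[OF \<open>x \<in> inputs n\<close>, of j] by (cases "j = Suc t") auto
    qed
    ultimately show ?thesis by (simp add: guess_def basis_def queries_def)
  qed
  have guess_eq: "guess t x = guess t y \<longleftrightarrow> agree t x y" for t x y
    using prefix_guess_eq_iff[of x t y] by (simp add: guess_def)
  have oracle_guess_eq: "oracle_map x (guess t x) = oracle_map y (guess t y) \<longleftrightarrow> agree (Suc t) x y"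
    if "t < n" "x \<in> inputs n" "y \<in> inputs n" for t x y
  proof -
    have "(x (Suc t) = 1 \<longleftrightarrow> y (Suc t) = 1) \<longleftrightarrow> x (Suc t) = y (Suc t)"
      using inputs_memD[OF that(2), of "Suc t"] inputs_memD[OF that(3), of "Suc t"] that(1) by auto
    then show ?thesis
      unfolding oracle_guess agree_Suc prod.inject prefix_guess_eq_iff by (simp add: of_bool_eq_iff)
  qed
  show ?thesis
  proof (rule quantum_computable_reversible[where pre = pre and d = 1 and s = "guess 0 (\<lambda>_. 1)"
        and out = "\<lambda>(q, a, w). if a = 1 then 1 else -1"])
    \<comment> \<open>\<open>guess_in\<close> asks for a member of \<open>inputs n\<close>, hence an
      extensional function; membership of the start label is therefore checked directly.\<close>
    have "restrict (\<lambda>_. 1) {1} \<in> {1::nat} \<rightarrow>\<^sub>E {-1, 1::int}" by (intro restrict_PiE_iff[THEN iffD2]) simp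
    moreover have "{1} \<in> prefix_sets n" using assms by (auto simp: prefix_sets_def image_iff intro!: bexI[of _ 1])
    moreover have "(\<lambda>_. 1)(Suc 0 := 1) = (\<lambda>_. 1 :: int)" by auto
    ultimately show "guess 0 (\<lambda>_. 1) \<in> ?B" by (simp add: guess_def basis_def queries_def)
    show "pre 0 x = guess 0 (\<lambda>_. 1)" for x
      using assms guess_eq[of 0 x] by (simp add: pre_def agree_def)
    show "pre t x \<in> ?B" if "x \<in> inputs n" for t x
      using that assms guess_in[of t x] guess_in[of "n - 1" x]
      by (simp add: pre_def oracle_map_in_basis del: oracle_map.simps)
    show "oracle_map x (pre t x) = oracle_map y (pre t y) \<longleftrightarrow> pre (Suc t) x = pre (Suc t) y"
      if "t < n" "x \<in> inputs n" "y \<in> inputs n" for t x y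
    proof (cases "Suc t < n")
      case True
      then show ?thesis using that by (simp only: pre_def if_True oracle_guess_eq guess_eq)
    next
      case False
      then have "t = n - 1" using that(1) by simp
      then show ?thesis using that(1) False by (simp only: pre_def if_True if_False)
    qed
    show "(case pre n x of (q, a, w) \<Rightarrow> if a = 1 then 1 else -1) = Dict n x" if "x \<in> inputs n" for x
      using inputs_memD[OF that, of n] assms
      by (auto simp: pre_def oracle_guess Dict_def simp del: oracle_map.simps)
  qed auto
qed

theorem corollaryB2:
  shows "\<exists>c C :: real. c > 0 \<and> C > 0 \<and>
    (\<forall>n::nat. n \<ge> 1 \<longrightarrow>
      ereal (c * real n)
        \<le> ereal_of_enat (quantum_query_complexity n (prefix_sets n) {-1, 1} (Dict n)) \<and>
      ereal_of_enat (quantum_query_complexity n (prefix_sets n) {-1, 1} (Dict n))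
        \<le> ereal (C * real n))"
proof (rule exI[of _ "1 / 360"], rule exI[of _ 1], intro conjI allI impI)
  fix n :: nat assume n: "n \<ge> 1"
  let ?K = "{T. quantum_computable n (prefix_sets n) {-1, 1} (Dict n) T}"
  have mem: "n \<in> ?K" using quantum_computable_Dict_upper[OF n] by simp
  \<comment> \<open>As some number of queries suffices, the infimum is attained, and the lower bound
    applies to the minimiser.\<close>
  then have "quantum_query_complexity n (prefix_sets n) {-1, 1} (Dict n) \<in> enat ` ?K"
    unfolding quantum_query_complexity_def by (intro wellorder_InfI) auto
  then obtain T where T: "quantum_query_complexity n (prefix_sets n) {-1, 1} (Dict n) = enat T"
    and "quantum_computable n (prefix_sets n) {-1, 1} (Dict n) T" by auto
  then have "real n \<le> 360 * real T" using quantum_computable_Dict_lower[OF n] by simp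
  then show "ereal (1 / 360 * real n)
      \<le> ereal_of_enat (quantum_query_complexity n (prefix_sets n) {-1, 1} (Dict n))"
    by (simp add: T)
  have "enat T \<le> enat n"
    unfolding T[symmetric] quantum_query_complexity_def using mem by (rule INF_lower)
  then show "ereal_of_enat (quantum_query_complexity n (prefix_sets n) {-1, 1} (Dict n))
      \<le> ereal (1 * real n)"
    by (simp add: T)
qed simp_all

end
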